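(* Let $q$ be a complex number with $0<|q|<1$. (1) Define sequences $(P_m)_{m\ge 0}$, $(Q_m)_{m\ge 0}$ by $$P_m=(1+q)P_{m-1}+(q^{2m-2}-q)P_{m-2}\quad(m\ge 2),\qquad P_0=1,\ P_1=1,$$ $$Q_m=(1+q)Q_{m-1}+(q^{2m-2}-q)Q_{m-2}\quad(m\ge 2),\qquad Q_0=0,\ Q_1=1.$$ Then for every integer $m\ge 1$, $$\sum_{n=0}^{\infty}\frac{q^{2n^2+2mn}}{(q;q)_{2n+1}}=\frac{q^{1-m}(q^3,q^5,q^8;q^8)_{\infty}(q^2,q^{14};q^{16})_{\infty}}{(q;q^2)_{m-1}(q;q)_{\infty}}P_{m-1}-\frac{q^{1-m}(q,q^7,q^8;q^8)_{\infty}(q^6,q^{10};q^{16})_{\infty}}{(q;q^2)_{m-1}(q;q)_{\infty}}Q_{m-1}.$$ (2) Define sequences $(A_m)_{m\ge 0}$, $(B_m)_{m\ge 0}$ by $$A_m=(1+q)A_{m-1}+(q^{2m-2}-q)A_{m-2}\quad(m\ge 2),\qquad A_0=1,\ A_1=1,$$ $$B_m=(1+q)B_{m-1}+(q^{2m-2}-q)B_{m-2}\quad(m\ge 2),\qquad B_0=0,\ B_1=q.$$ Then for every integer $m\ge 0$, $$\sum_{n=0}^{\infty}\frac{q^{2n^2+2mn}}{(q;q)_{2n}}=\frac{(q,q^7,q^8;q^8)_{\infty}(q^6,q^{10};q^{16})_{\infty}}{(q;q^2)_m(q;q)_{\infty}}A_m-\frac{(q^3,q^5,q^8;q^8)_{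\infty}(q^2,q^{14};q^{16})_{\infty}}{(q;q^2)_m(q;q)_{\infty}}B_m.$$
   Context: For $|p|<1$, $(a;p)_\infty=\prod_{k=0}^{\infty}(1-ap^k)$ and, for an integer $n\ge 0$, $(a;p)_n=\prod_{k=0}^{n-1}(1-ap^k)$. Multiple $q$-shifted factorials are products: $(a_1,\dots,a_r;p)_\infty=(a_1;p)_\infty\cdots(a_r;p)_\infty$. *)

theory Defs
  imports "HOL-Analysis.Analysis"
begin

text \<open>The $q$-shifted factorials $(a;p)_n$ and $(a;p)_\infty$. The infinite product is
  meaningful for \<open>norm p < 1\<close>; \<open>prodinf\<close> allows for vanishing factors.\<close>

definition qpoch :: "complex \<Rightarrow> complex \<Rightarrow> nat \<Rightarrow> complex" where
  "qpoch a p n = (\<Prod>k<n. 1 - a * p ^ k)"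

definition qpoch_inf :: "complex \<Rightarrow> complex \<Rightarrow> complex" where
  "qpoch_inf a p = (\<Prod>k. 1 - a * p ^ k)"

definition qpochs_inf :: "complex list \<Rightarrow> complex \<Rightarrow> complex" where
  "qpochs_inf as p = (\<Prod>a\<leftarrow>as. qpoch_inf a p)"

end

theory Submission imports Defs begin

text \<open>Write $E_m$ and $O_m$ for the sums with denominators $(q;q)_{2n}$ and $(q;q)_{2n+1}$. Comparing terms
  gives $E_m = O_m - q\,O_{m+1}$ and $E_m - E_{m+1} = q^{2m+2} O_{m+2}$, hence three-term recurrences
  for both families which, after multiplication by $(q;q^2)_m$ (and by $q^m$ for $O_{m+1}$), are those of
  $A, B, P, Q$. It remains to evaluate $E_0$ and $O_1$. With $t^2 = q$, Euler's identity gives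
  $E_0 + t\,O_1 = (-t;q)_\<infinity> = (-t;-t)_\<infinity> / (q;q)_\<infinity>$. The even and odd exponents of the pentagonal
  number series of $(-t;-t)_\<infinity>$ are the two sides of instances of the quintuple product identity,
  which yields the two stated products.\<close>

section \<open>Infinite shifted factorials\<close>

text \<open>A square root t of q enters because the k-th term of Euler's series at x = t q^m carries
  q to the power k^2/2 + m k, half-integral exactly for odd k. Even k give the terms of E_m; odd k
  give t q^m times those of O_{m+1}, which is why E_0 is paired with O_1. The pairs P, Q and A, B
  are fundamental solutions of one recurrence; their initial values encode q (1 - q) O_2 = O_1 - E_0
  and (1 - q) E_1 = E_0 - q O_1. The analytic obstacle is the passage to infinite products: Euler's
  identity and the triple product are both limits of the finite q-binomial theorem, and taking the
  limit under the sum requires a bound on the q-binomial coefficients that is uniform in both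
  indices.\<close>

lemma qpoch_simps [simp]:
  "qpoch a p 0 = 1" "qpoch a p (Suc n) = qpoch a p n * (1 - a * p ^ n)"
  by (simp_all add: qpoch_def)

lemma convergent_prod_qpoch:
  fixes a p :: complex
  assumes "norm p < 1"
  shows "convergent_prod (\<lambda>k. 1 - a * p ^ k)"
proof -
  have "summable (\<lambda>k. norm a * norm p ^ k)"
    using assms by (intro summable_mult summable_geometric) auto
  then show ?thesis
    by (intro abs_convergent_prod_imp_convergent_prod summable_imp_abs_convergent_prod)
       (simp add: norm_mult norm_power)
qed

lemma qpoch_tendsto:
  assumes "norm p < 1"
  shows "qpoch a p \<longlonglongrightarrow> qpoch_inf a p"
\<comment> \<open>\<open>convergent_prod_LIMSEQ\<close> speaks of products over
  \<open>{..n}\<close>, while \<open>qpoch\<close> stops before \<open>n\<close>; hence the offset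
  by one.\<close>
proof (rule LIMSEQ_offset[where k = 1])
  show "(\<lambda>n. qpoch a p (n + 1)) \<longlonglongrightarrow> qpoch_inf a p"
    using convergent_prod_LIMSEQ[OF convergent_prod_qpoch[OF assms, of a]]
    by (simp only: qpoch_def qpoch_inf_def Suc_eq_plus1[symmetric] lessThan_Suc_atMost)
qed

lemma power_neq_1:
  fixes p :: complex
  assumes "norm p < 1" "n > 0"
  shows "p ^ n \<noteq> 1"
  using assms power_eq_1_iff by fastforce

lemma qpoch_self_nz: "norm p < 1 \<Longrightarrow> qpoch p p n \<noteq> 0"
  using power_neq_1[of p "Suc _"] by (auto simp: qpoch_def)

lemma qpoch_inf_self_nz:
  assumes "norm p < 1"
  shows "qpoch_inf p p \<noteq> 0"
  unfolding qpoch_inf_def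
proof (rule prodinf_nonzero[OF convergent_prod_qpoch[OF assms]])
  show "1 - p * p ^ i \<noteq> 0" for i
    using power_neq_1[OF assms, of "Suc i"] by simp
qed

text \<open>Sorts the factors by the residue r of the exponent m k + r modulo k. This is exact for
  the partial products of length n k, a subsequence of a convergent sequence.\<close>

lemma qpoch_inf_dissect:
  assumes "norm p < 1" "k > 0"
  shows "qpoch_inf a p = (\<Prod>r<k. qpoch_inf (a * p ^ r) (p ^ k))"
proof -
  have pk: "norm (p ^ k) < 1"
    using assms by (simp add: norm_power power_less_one_iff)
  have "p ^ (m * k) = (p ^ k) ^ m" for m
    by (metis power_mult mult.commute)
  then have shift: "a * p ^ (m * k + r) = a * p ^ r * (p ^ k) ^ m" for m r
    by (simp add: power_add)
  have "qpoch a p (n * k) = (\<Prod>r<k. qpoch (a * p ^ r) (p ^ k) n)" for n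
  proof -
    have "qpoch a p (n * k) = (\<Prod>m<n. \<Prod>i\<in>{m * k..<m * k + k}. 1 - a * p ^ i)"
      unfolding qpoch_def by (rule prod.nat_group[symmetric])
    also have "\<dots> = (\<Prod>m<n. \<Prod>r<k. 1 - a * p ^ (m * k + r))"
    proof (rule prod.cong[OF refl])
      fix m
      show "(\<Prod>i\<in>{m * k..<m * k + k}. 1 - a * p ^ i) = (\<Prod>r<k. 1 - a * p ^ (m * k + r))"
        using prod.shift_bounds_nat_ivl[of "\<lambda>i. 1 - a * p ^ i" 0 "m * k" k]
        by (simp add: atLeast0LessThan add.commute)
    qed
    also have "\<dots> = (\<Prod>r<k. \<Prod>m<n. 1 - a * p ^ (m * k + r))"
      by (rule prod.swap)
    finally show ?thesis
      by (simp only: qpoch_def shift)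
  qed
  moreover have "(\<lambda>n. \<Prod>r<k. qpoch (a * p ^ r) (p ^ k) n)
      \<longlonglongrightarrow> (\<Prod>r<k. qpoch_inf (a * p ^ r) (p ^ k))"
    by (intro tendsto_prod qpoch_tendsto pk)
  moreover have "filterlim (\<lambda>n. n * k) sequentially sequentially"
    using assms(2) by (intro filterlim_subseq strict_monoI) auto
  then have "(\<lambda>n. qpoch a p (n * k)) \<longlonglongrightarrow> qpoch_inf a p"
    by (rule filterlim_compose[OF qpoch_tendsto[OF assms(1)]])
  ultimately show ?thesis
    by (metis (no_types, lifting) LIMSEQ_unique ext)
qed

section \<open>Triangular exponents and dominated convergence\<close>

text \<open>The binomial coefficient \<open>k\<close> over 2, continued to negative \<open>k\<close>
  for the bilateral series. The division is exact, so later arguments go through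
  \<open>two_tri\<close>.\<close>

definition tri :: "int \<Rightarrow> int" where
  "tri k = k * (k - 1) div 2"

lemma two_tri: "2 * tri k = k * (k - 1)"
  unfolding tri_def by (rule dvd_mult_div_cancel) (cases "even k"; simp)

lemma tri_simps [simp]: "tri 0 = 0" "tri 1 = 0"
  by (simp_all add: tri_def)

lemma tri_add_1: "tri (k + 1) = tri k + k"
  using two_tri[of k] two_tri[of "k + 1"] by (simp add: algebra_simps)

lemma tri_add: "tri (i + j) = tri i + tri j + i * j"
  using two_tri[of i] two_tri[of j] two_tri[of "i + j"] by (simp add: algebra_simps)

text \<open>Tannery's theorem: by the Weierstrass M-test the finite partial sums converge uniformly
  in \<open>n\<close>, so the limit in \<open>n\<close> may be exchanged with the sum.\<close>

lemma has_sum_dominated: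
  fixes f :: "nat \<Rightarrow> 'a \<Rightarrow> 'b :: banach"
  assumes bound: "\<And>n x. x \<in> X \<Longrightarrow> norm (f n x) \<le> M x" and M: "M summable_on X"
    and lim: "\<And>x. x \<in> X \<Longrightarrow> (\<lambda>n. f n x) \<longlonglongrightarrow> g x"
    and sum: "\<And>n. (f n has_sum S n) X" and L: "S \<longlonglongrightarrow> L"
  shows "(g has_sum L) X"
proof -
  have "norm (g x) \<le> M x" if "x \<in> X" for x
    by (rule tendsto_upperbound[OF tendsto_norm[OF lim[OF that]]]) (use bound that in simp_all)
  then have "g summable_on X"
    by (rule Infinite_Sum.abs_summable_summable[OF Infinite_Sum.abs_summable_on_comparison_test'[OF M]])
  then have g: "(g has_sum infsum g X) X" by simp
  have "S \<longlonglongrightarrow> infsum g X"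
  proof (rule swap_uniform_limit'[where F = "finite_subsets_at_top X" and S = UNIV])
    show "uniform_limit UNIV (\<lambda>Y n. \<Sum>x\<in>Y. f n x) S (finite_subsets_at_top X)"
      by (rule Weierstrass_m_test_general'[OF bound sum M])
    show "\<forall>\<^sub>F Y in finite_subsets_at_top X. (\<lambda>n. \<Sum>x\<in>Y. f n x) \<longlonglongrightarrow> sum g Y"
      by (intro eventually_finite_subsets_at_top_weakI tendsto_sum) (auto intro: lim)
    show "(sum g \<longlongrightarrow> infsum g X) (finite_subsets_at_top X)"
      using g by (simp add: has_sum_def)
  qed auto
  with L have "L = infsum g X" by (rule LIMSEQ_unique)
  then show ?thesis using g by simp
qed

lemma power_int_tri_Suc:
  fixes q :: "'a :: field"
  assumes "q \<noteq> 0"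
  shows "q powi tri (int (Suc n)) = q powi tri (int n) * q ^ n"
  using assms tri_add_1[of "int n"] by (simp add: power_int_add add.commute)

text \<open>Consecutive terms have ratio r^n x, which tends to 0 however large \<open>x\<close> is;
  1/2 is just a convenient bound below 1.\<close>

lemma summable_powi_tri:
  fixes r x :: real
  assumes "0 < r" "r < 1" "0 \<le> x"
  shows "summable (\<lambda>n. r powi tri (int n) * x ^ n)"
proof -
  have "(\<lambda>n. r ^ n * x) \<longlonglongrightarrow> 0"
    using assms by (intro tendsto_mult_left_zero LIMSEQ_realpow_zero) auto
  then have "\<forall>\<^sub>F n in sequentially. r ^ n * x < 1/2"
    by (rule order_tendstoD) simp
  then obtain N where N: "\<And>n. n \<ge> N \<Longrightarrow> r ^ n * x < 1/2"
    by (auto simp: eventually_at_top_linorder)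
  show ?thesis
  proof (rule summable_ratio_test[where c = "1/2" and N = N])
    fix n assume "N \<le> n"
    have "norm (r powi tri (int (Suc n)) * x ^ Suc n) = (r ^ n * x) * norm (r powi tri (int n) * x ^ n)"
      using assms by (subst power_int_tri_Suc) (auto simp: abs_mult)
    also have "\<dots> \<le> 1/2 * norm (r powi tri (int n) * x ^ n)"
      using N[OF \<open>N \<le> n\<close>] by (intro mult_right_mono) auto
    finally show "norm (r powi tri (int (Suc n)) * x ^ Suc n) \<le> 1/2 * norm (r powi tri (int n) * x ^ n)" .
  qed simp
qed

lemma theta_summable:
  fixes q z :: complex
  assumes "0 < norm q" "norm q < 1" "z \<noteq> 0"
  shows "(\<lambda>j. norm (q powi tri j * z powi j)) summable_on UNIV"
proof -
  let ?f = "\<lambda>j. norm (q powi tri j * z powi j)"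
  have "?f summable_on {0..}"
  proof (subst summable_on_reindex_bij_witness[of _ int nat UNIV "\<lambda>n. ?f (int n)"])
    have "summable (\<lambda>n. norm q powi tri (int n) * norm z ^ n)"
      using assms by (intro summable_powi_tri) auto
    then show "(\<lambda>n. ?f (int n)) summable_on UNIV"
      by (intro norm_summable_imp_summable_on) (simp add: norm_mult norm_power norm_power_int)
  qed auto
  moreover have "?f summable_on {..<0}"
  \<comment> \<open>The substitution j = -1 - n turns the negative half into q/z times the one-sided
    series at q^2/z.\<close>
  proof (subst summable_on_reindex_bij_witness[of _ "\<lambda>n. - 1 - int n" "\<lambda>j. nat (- 1 - j)" UNIV "\<lambda>n. ?f (- 1 - int n)"])
    have "tri (- 1 - int n) = tri (int n) + 2 * int n + 1" for n
      using two_tri[of "- 1 - int n"] two_tri[of "int n"] by (simp add: algebra_simps)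
    moreover have "q powi (2 * int n) = (q\<^sup>2) ^ n" for n
      using power_int_of_nat[of q "2 * n"] by (simp add: power_mult)
    moreover have "z powi (- 1 - int n) = 1 / (z * z ^ n)" for n
      using power_int_minus[of z "1 + int n"] assms by (simp add: power_int_add field_simps)
    ultimately have "?f (- 1 - int n) = norm q / norm z * (norm q powi tri (int n) * ((norm q)\<^sup>2 / norm z) ^ n)" for n
      using assms by (simp add: norm_mult norm_divide norm_power norm_power_int power_int_add power_divide)
    moreover have "summable (\<lambda>n. norm q / norm z * (norm q powi tri (int n) * ((norm q)\<^sup>2 / norm z) ^ n))"
      using assms by (intro summable_powi_tri summable_mult) auto
    ultimately show "(\<lambda>n. ?f (- 1 - int n)) summable_on UNIV"
      by (intro norm_summable_imp_summable_on) simp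
  qed auto
  ultimately have "?f summable_on ({0..} \<union> {..<0})"
    by (intro summable_on_Un_disjoint) auto
  moreover have "{0..} \<union> {..<0} = (UNIV :: int set)" by auto
  ultimately show ?thesis by simp
qed

section \<open>Euler's identity and the Jacobi triple product\<close>

text \<open>The Gaussian binomial coefficient. Truncated subtraction would give a non-zero quotient
  for \<open>k > n\<close>; the explicit 0 lets finite sums be read as sums over all
  \<open>k\<close>.\<close>

definition qbin :: "complex \<Rightarrow> nat \<Rightarrow> nat \<Rightarrow> complex" where
  "qbin q n k = (if k \<le> n then qpoch q q n / (qpoch q q k * qpoch q q (n - k)) else 0)"

text \<open>Of the two q-Pascal rules, the one suited to appending the factor 1 + x q^n: its weight
  q^(n-k) meets the q^k gained in the triangular exponent, and together they give q^n.\<close>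

lemma qbin_Suc_Suc:
  assumes "norm q < 1" "k \<le> n"
  shows "qbin q (Suc n) (Suc k) = qbin q n (Suc k) + q ^ (n - k) * qbin q n k"
proof (cases "k = n")
  case True
  then show ?thesis using assms qpoch_self_nz[of q] by (simp add: qbin_def del: qpoch_simps(2))
next
  case False
  with assms(2) obtain d where n: "n = Suc (k + d)"
    using less_imp_Suc_add[of k n] by auto
  have "1 - q * q ^ i \<noteq> 0" for i
    using power_neq_1[OF assms(1), of "Suc i"] by simp
  then show ?thesis
    using qpoch_self_nz[OF assms(1)] by (simp add: n qbin_def divide_simps) (simp add: algebra_simps power_add)
qed

lemma qbinomial_theorem:
  assumes "norm q < 1" "q \<noteq> 0"
  shows "qpoch (- x) q n = (\<Sum>k\<le>n. qbin q n k * (q powi tri (int k) * x ^ k))"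
proof (induction n)
  case (Suc n)
  let ?t = "\<lambda>k. q powi tri (int k) * x ^ k"
  have "(\<Sum>k\<le>Suc n. qbin q (Suc n) k * ?t k)
      = 1 + (\<Sum>k\<le>n. qbin q (Suc n) (Suc k) * ?t (Suc k))"
    using qpoch_self_nz[OF assms(1), of "Suc n"]
    by (subst sum.atMost_Suc_shift) (simp add: qbin_def del: qpoch_simps(2))
  also have "(\<Sum>k\<le>n. qbin q (Suc n) (Suc k) * ?t (Suc k))
      = (\<Sum>k\<le>n. qbin q n (Suc k) * ?t (Suc k) + x * q ^ n * (qbin q n k * ?t k))"
  proof (intro sum.cong refl)
    fix k assume "k \<in> {..n}"
    then have k: "k \<le> n" by simp
    then have "q ^ n = q ^ (n - k) * q ^ k" by (simp flip: power_add)
    then show "qbin q (Suc n) (Suc k) * ?t (Suc k)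
        = qbin q n (Suc k) * ?t (Suc k) + x * q ^ n * (qbin q n k * ?t k)"
      by (simp only: qbin_Suc_Suc[OF assms(1) k] power_int_tri_Suc[OF assms(2)] power_Suc)
         (simp add: algebra_simps)
  qed
  also have "1 + \<dots> = (1 + (\<Sum>k\<le>n. qbin q n (Suc k) * ?t (Suc k))) + x * q ^ n * (\<Sum>k\<le>n. qbin q n k * ?t k)"
    by (simp only: sum.distrib sum_distrib_left add.assoc)
  also have "1 + (\<Sum>k\<le>n. qbin q n (Suc k) * ?t (Suc k)) = (\<Sum>k\<le>Suc n. qbin q n k * ?t k)"
    using qpoch_self_nz[OF assms(1), of n]
    by (subst sum.atMost_Suc_shift) (simp add: qbin_def del: qpoch_simps(2))
  also have "\<dots> = (\<Sum>k\<le>n. qbin q n k * ?t k)"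
    by (simp add: qbin_def)
  finally show ?case
    by (simp only: Suc.IH[symmetric] qpoch_simps) (simp add: algebra_simps)
qed (simp add: qbin_def)

text \<open>The sequence converges to a non-zero limit, so its inverses are bounded too. This yields
  the uniform bound on \<open>qbin\<close> that dominates both limits below.\<close>

lemma qpoch_self_bounds:
  assumes "norm q < 1"
  obtains K where "K > 0" "\<And>n. norm (qpoch q q n) \<le> K" "\<And>n. norm (inverse (qpoch q q n)) \<le> K"
proof -
  have "Bseq (qpoch q q)"
    using qpoch_tendsto[OF assms] by (intro convergent_imp_Bseq convergentI)
  moreover have "Bseq (\<lambda>n. inverse (qpoch q q n))"
    using tendsto_inverse[OF qpoch_tendsto[OF assms] qpoch_inf_self_nz[OF assms]]
    by (intro convergent_imp_Bseq convergentI)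
  ultimately obtain K L where "K > 0" "\<And>n. norm (qpoch q q n) \<le> K"
    and "L > 0" "\<And>n. norm (inverse (qpoch q q n)) \<le> L"
    unfolding Bseq_def by blast
  then show thesis
    by (intro that[of "max K L"]) (auto simp: le_max_iff_disj)
qed

lemma qbin_bound:
  assumes "norm q < 1"
  obtains C where "\<And>n k. norm (qbin q n k) \<le> C"
proof -
  obtain K where K: "K > 0" "\<And>n. norm (qpoch q q n) \<le> K" "\<And>n. norm (inverse (qpoch q q n)) \<le> K"
    using qpoch_self_bounds[OF assms] by blast
  have "norm (qbin q n k) \<le> K * K * K" for n k
  proof -
    have "norm (qpoch q q n) * norm (inverse (qpoch q q k)) * norm (inverse (qpoch q q (n - k))) \<le> K * K * K"
      using K by (intro mult_mono) auto
    then show ?thesis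
      using K(1) by (simp add: qbin_def norm_mult norm_divide norm_inverse divide_simps)
  qed
  then show thesis using that by blast
qed

lemma qbin_tendsto:
  assumes "norm q < 1"
  shows "(\<lambda>n. qbin q n k) \<longlonglongrightarrow> 1 / qpoch q q k"
proof -
  have "(\<lambda>n. qpoch q q n / (qpoch q q k * qpoch q q (n - k))) \<longlonglongrightarrow>
      qpoch_inf q q / (qpoch q q k * qpoch_inf q q)"
    using assms qpoch_self_nz qpoch_inf_self_nz
    by (intro tendsto_intros qpoch_tendsto filterlim_compose[OF qpoch_tendsto filterlim_minus_const_nat_at_top]) auto
  moreover have "\<forall>\<^sub>F n in sequentially. qpoch q q n / (qpoch q q k * qpoch q q (n - k)) = qbin q n k"
    using eventually_ge_at_top[of k] by eventually_elim (simp add: qbin_def)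
  ultimately show ?thesis
    using qpoch_inf_self_nz[OF assms] by (simp add: tendsto_cong)
qed

text \<open>The three lengths 2n, n + j and n - j all tend to infinity, so one factor of the limit
  cancels. The value of \<open>nat\<close> at negative arguments only concerns finitely many
  \<open>n\<close>.\<close>

lemma qbin_central_tendsto:
  assumes "norm q < 1"
  shows "(\<lambda>n. qbin q (2 * n) (nat (int n + j))) \<longlonglongrightarrow> 1 / qpoch_inf q q"
proof -
  have lim: "filterlim (\<lambda>n. nat (int n + i)) sequentially sequentially" for i
    unfolding filterlim_at_top
  proof
    fix Z
    show "\<forall>\<^sub>F n in sequentially. Z \<le> nat (int n + i)"
      using eventually_ge_at_top[of "nat (int Z - i)"] by eventually_elim auto
  qed
  have "(\<lambda>n. qpoch q q (2 * n) / (qpoch q q (nat (int n + j)) * qpoch q q (nat (int n + (- j))))) \<longlonglongrightarrow>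
      qpoch_inf q q / (qpoch_inf q q * qpoch_inf q q)"
    using assms qpoch_inf_self_nz
    by (intro tendsto_divide tendsto_mult filterlim_compose[OF qpoch_tendsto] lim
          mult_nat_left_at_top) auto
  moreover have "\<forall>\<^sub>F n in sequentially.
      qpoch q q (2 * n) / (qpoch q q (nat (int n + j)) * qpoch q q (nat (int n + (- j))))
      = qbin q (2 * n) (nat (int n + j))"
    using eventually_ge_at_top[of "nat \<bar>j\<bar>"]
  proof eventually_elim
    case (elim n)
    then have "nat (int n + j) \<le> 2 * n" "2 * n - nat (int n + j) = nat (int n + (- j))" by linarith+
    then show ?case by (simp add: qbin_def)
  qed
  ultimately show ?thesis
    using qpoch_inf_self_nz[OF assms] by (simp add: tendsto_cong)
qed

text \<open>The q-binomial theorem for n tending to infinity, dominated by a constant times the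
  terms without coefficients.\<close>

lemma euler_identity:
  fixes q x :: complex
  assumes "norm q < 1" "q \<noteq> 0"
  shows "((\<lambda>k. q powi tri (int k) * x ^ k / qpoch q q k) has_sum qpoch_inf (- x) q) UNIV"
proof -
  obtain C where C: "\<And>n k. norm (qbin q n k) \<le> C"
    using qbin_bound[OF assms(1)] by blast
  let ?t = "\<lambda>k. q powi tri (int k) * x ^ k"
  have "((\<lambda>k. 1 / qpoch q q k * ?t k) has_sum qpoch_inf (- x) q) UNIV"
  proof (rule has_sum_dominated[where f = "\<lambda>n k. qbin q n k * ?t k" and M = "\<lambda>k. C * norm (?t k)"])
    show "norm (qbin q n k * ?t k) \<le> C * norm (?t k)" for n k
      using C[of n k] by (subst norm_mult) (intro mult_right_mono, auto)
    have "summable (\<lambda>k. norm q powi tri (int k) * norm x ^ k)"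
      using assms by (intro summable_powi_tri) auto
    then show "(\<lambda>k. C * norm (?t k)) summable_on UNIV"
      by (intro summable_on_cmult_right norm_summable_imp_summable_on)
         (simp add: norm_mult norm_power norm_power_int)
    show "(\<lambda>n. qbin q n k * ?t k) \<longlonglongrightarrow> 1 / qpoch q q k * ?t k" for k
      by (intro tendsto_mult_right qbin_tendsto assms)
    show "((\<lambda>k. qbin q n k * ?t k) has_sum qpoch (- x) q n) UNIV" for n
      by (rule has_sum_finite_neutralI[where B = "{..n}"])
         (auto simp: qbinomial_theorem[OF assms] qbin_def)
  qed (rule qpoch_tendsto[OF assms(1)])
  then show ?thesis by simp
qed

text \<open>The $q$-binomial theorem of order $2n$ at $zq^{-n}$, recentred at the middle term.\<close>

lemma jacobi_triple_product_finite:
  fixes q z :: complex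
  assumes "norm q < 1" "q \<noteq> 0" "z \<noteq> 0"
  shows "qpoch (- z) q n * qpoch (- (q / z)) q n
    = (\<Sum>j\<in>{- int n..int n}. qbin q (2 * n) (nat (int n + j)) * (q powi tri j * z powi j))"
proof -
  define x where "x = z * q powi (- int n)"
  \<comment> \<open>The lower half of the product consists of 1 + z q^(-i) = z q^(-i) (1 + q^i / z)
    for i = 1, ..., n; \<open>c\<close> collects the factors pulled out.\<close>
  define c where "c = z ^ n * q powi (- tri (int n + 1))"
  have "c \<noteq> 0" using assms by (simp add: c_def)
  have low: "(\<Prod>k<n. 1 + x * q ^ k) = c * qpoch (- (q / z)) q n"
  proof -
    have "(\<Prod>k<n. 1 + x * q ^ k) = (\<Prod>i<n. 1 + x * q ^ (n - Suc i))"
      by (rule prod.nat_diff_reindex[symmetric])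
    also have "\<dots> = (\<Prod>i<n. 1 + z * q powi (- int (Suc i)))"
    proof (intro prod.cong refl)
      fix i assume "i \<in> {..<n}"
      then have "int (n - Suc i) = int n - int (Suc i)" by auto
      then have "q powi (- int (Suc i)) = q powi (- int n) * q powi (int (n - Suc i))"
        using assms by (subst power_int_add[symmetric]) auto
      then show "1 + x * q ^ (n - Suc i) = 1 + z * q powi (- int (Suc i))"
        by (simp add: x_def)
    qed
    also have "\<dots> = c * qpoch (- (q / z)) q n"
      unfolding c_def
    proof (induction n)
      case (Suc n)
      have "tri (int (Suc n) + 1) = tri (int n + 1) + int (Suc n)"
        using tri_add_1[of "int n + 1"] by (simp add: add.commute)
      then have "q powi (- tri (int (Suc n) + 1)) = q powi (- tri (int n + 1)) * q powi (- int (Suc n))"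
        using assms by (subst power_int_add[symmetric]) auto
      moreover have "1 + z * q powi (- int (Suc n)) = z * q powi (- int (Suc n)) * (1 - - (q / z) * q ^ n)"
      proof -
        have "q powi (- int (Suc n)) = 1 / (q * q ^ n)"
          by (simp only: power_int_minus power_int_of_nat power_Suc) (simp add: field_simps)
        then show ?thesis using assms by (simp only:) (simp add: field_simps)
      qed
      ultimately show ?case
        using Suc.IH by (simp only: prod.lessThan_Suc qpoch_simps power_Suc) (simp add: mult_ac)
    qed simp
    finally show ?thesis .
  qed
  have "qpoch (- x) q (2 * n) = (\<Prod>k<n. 1 + x * q ^ k) * (\<Prod>k<n. 1 + x * q ^ (n + k))"
  proof -
    have "qpoch (- x) q (n + m) = (\<Prod>k<n. 1 + x * q ^ k) * (\<Prod>k<m. 1 + x * q ^ (n + k))" for m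
      by (induction m) (simp_all add: qpoch_def)
    from this[of n] show ?thesis by (simp add: mult_2)
  qed
  also have "(\<Prod>k<n. 1 + x * q ^ (n + k)) = qpoch (- z) q n"
    using assms by (simp add: x_def qpoch_def power_add power_int_minus field_simps)
  also note low
  also have "qpoch (- x) q (2 * n) = (\<Sum>k\<le>2 * n. qbin q (2 * n) k * (q powi tri (int k) * x ^ k))"
    using assms by (simp add: qbinomial_theorem)
  also have "\<dots> = (\<Sum>j\<in>{- int n..int n}. c * (qbin q (2 * n) (nat (int n + j)) * (q powi tri j * z powi j)))"
  proof (rule sum.reindex_bij_witness[where i = "\<lambda>j. nat (int n + j)" and j = "\<lambda>k. int k - int n"])
    fix k assume "k \<in> {..2 * n}"
    define j where "j = int k - int n"
    have k: "int k = int n + j" by (simp add: j_def)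
    \<comment> \<open>With k = n + j the cross term n j of tri(n + j) cancels against the power of q
      in x^k, leaving tri(j) and the exponent of \<open>c\<close>.\<close>
    have "tri (int k) + - (int n * int k) = - tri (int n + 1) + tri j"
      using tri_add[of "int n" j] tri_add[of "int n" 1] two_tri[of "int n"] by (simp add: k algebra_simps)
    then have "q powi tri (int k) * q powi (- (int n * int k)) = q powi (- tri (int n + 1)) * q powi tri j"
      using assms by (simp only: power_int_add[symmetric] simp_thms)
    moreover have "x ^ k = z ^ n * z powi j * q powi (- (int n * int k))"
    proof -
      have "x ^ k = z powi (int n + j) * (q powi (- int n)) powi int k"
        unfolding x_def k[symmetric] power_int_of_nat by (simp add: power_mult_distrib)
      also have "(q powi (- int n)) powi int k = q powi (- (int n * int k))"
        by (simp only: power_int_mult[symmetric] mult_minus_left)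
      finally show ?thesis using assms by (simp add: power_int_add)
    qed
    ultimately have "q powi tri (int k) * x ^ k = c * (q powi tri j * z powi j)"
      by (simp add: c_def mult_ac)
    then show "c * (qbin q (2 * n) (nat (int n + (int k - int n))) * (q powi tri (int k - int n) * z powi (int k - int n)))
        = qbin q (2 * n) k * (q powi tri (int k) * x ^ k)"
      by (simp add: j_def)
  qed auto
  also have "\<dots> = c * (\<Sum>j\<in>{- int n..int n}. qbin q (2 * n) (nat (int n + j)) * (q powi tri j * z powi j))"
    by (simp add: sum_distrib_left)
  finally show ?thesis
    using \<open>c \<noteq> 0\<close> by (simp add: mult_ac)
qed

text \<open>Limit of the finite form. The central coefficients tend to the inverse of
  \<open>qpoch_inf q q\<close>, which becomes the third factor of the product.\<close>

lemma jacobi_triple_product: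
  fixes q z :: complex
  assumes "norm q < 1" "q \<noteq> 0" "z \<noteq> 0"
  shows "((\<lambda>j. q powi tri j * z powi j) has_sum
           qpoch_inf q q * qpoch_inf (- z) q * qpoch_inf (- (q / z)) q) UNIV"
proof -
  obtain C where C: "\<And>n k. norm (qbin q n k) \<le> C"
    using qbin_bound[OF assms(1)] by blast
  then have "C \<ge> 0" using norm_ge_zero order_trans by blast
  let ?t = "\<lambda>j. q powi tri j * z powi j"
  \<comment> \<open>Extension by zero outside the window places all finite sums on one index set, as
    dominated convergence requires.\<close>
  let ?f = "\<lambda>n j. if j \<in> {- int n..int n} then qbin q (2 * n) (nat (int n + j)) * ?t j else 0"
  have "((\<lambda>j. 1 / qpoch_inf q q * ?t j) has_sum qpoch_inf (- z) q * qpoch_inf (- (q / z)) q) UNIV"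
  proof (rule has_sum_dominated[where f = ?f and M = "\<lambda>j. C * norm (?t j)"])
    show "norm (?f n j) \<le> C * norm (?t j)" for n j
    proof (cases "j \<in> {- int n..int n}")
      case True
      have "norm (qbin q (2 * n) (nat (int n + j)) * ?t j) \<le> C * norm (?t j)"
        using C by (subst norm_mult) (intro mult_right_mono, auto)
      then show ?thesis using True by (simp only: if_True)
    next
      case False
      then show ?thesis using \<open>C \<ge> 0\<close> by (simp only: if_False) simp
    qed
    show "(\<lambda>j. C * norm (?t j)) summable_on UNIV"
      using assms by (intro summable_on_cmult_right theta_summable) auto
    show "(\<lambda>n. ?f n j) \<longlonglongrightarrow> 1 / qpoch_inf q q * ?t j" for j
    proof (rule Lim_transform_eventually)
      show "(\<lambda>n. qbin q (2 * n) (nat (int n + j)) * ?t j) \<longlonglongrightarrow> 1 / qpoch_inf q q * ?t j"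
        by (intro tendsto_mult_right qbin_central_tendsto assms)
      show "\<forall>\<^sub>F n in sequentially. qbin q (2 * n) (nat (int n + j)) * ?t j = ?f n j"
        using eventually_ge_at_top[of "nat \<bar>j\<bar>"]
      proof eventually_elim
        case (elim n)
        then have "j \<in> {- int n..int n}" by auto
        then show ?case by (simp only: if_True)
      qed
    qed
    show "(?f n has_sum qpoch (- z) q n * qpoch (- (q / z)) q n) UNIV" for n
      by (rule has_sum_finite_neutralI[where B = "{- int n..int n}"])
         (auto simp: jacobi_triple_product_finite[OF assms])
  qed (intro tendsto_mult qpoch_tendsto assms(1))
  from has_sum_cmult_right[OF this, of "qpoch_inf q q"] show ?thesis
    using qpoch_inf_self_nz[OF assms(1)] by (simp add: mult.assoc)
qed

section \<open>The quintuple product\<close>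

lemma has_sum_product_abs:
  fixes f :: "'a \<Rightarrow> 'c :: {banach, real_normed_field}" and g :: "'b \<Rightarrow> 'c"
  assumes f: "(\<lambda>i. norm (f i)) summable_on A" and g: "(\<lambda>j. norm (g j)) summable_on B"
  shows "((\<lambda>(i, j). f i * g j) has_sum (infsum f A * infsum g B)) (A \<times> B)"
proof (rule has_sum_SigmaI)
  have f': "(f has_sum infsum f A) A" and g': "(g has_sum infsum g B) B"
    using Infinite_Sum.abs_summable_summable[OF f] Infinite_Sum.abs_summable_summable[OF g] by simp_all
  show "((\<lambda>j. case (i, j) of (i, j) \<Rightarrow> f i * g j) has_sum f i * infsum g B) B" for i
    using has_sum_cmult_right[OF g'] by simp
  show "((\<lambda>i. f i * infsum g B) has_sum infsum f A * infsum g B) A"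
    by (rule has_sum_cmult_left[OF f'])
  have "(\<lambda>p. norm (case p of (i, j) \<Rightarrow> f i * g j)) summable_on A \<times> B"
    unfolding Infinite_Sum.abs_summable_on_Sigma_iff
    using f g by (auto simp: norm_mult infsum_cmult_right' abs_mult infsum_nonneg
        intro!: summable_on_cmult_left summable_on_cmult_right)
  then show "(\<lambda>(i, j). f i * g j) summable_on A \<times> B"
    by (rule Infinite_Sum.abs_summable_summable)
qed

text \<open>Serves to sort a series by residues: modulo 3 for the quintuple product, modulo 4 for
  the pentagonal series, modulo 2 for Euler's series.\<close>

lemma has_sum_fibres:
  fixes f :: "'a \<Rightarrow> 'b :: banach"
  assumes f: "(f has_sum s) T" and R: "finite R" and h: "bij_betw h (R \<times> B) T"
  shows "s = (\<Sum>r\<in>R. \<Sum>\<^sub>\<infinity>b\<in>B. f (h (r, b)))"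
    and "r \<in> R \<Longrightarrow> (\<lambda>b. f (h (r, b))) summable_on B"
proof -
  have fh: "((\<lambda>p. f (h p)) has_sum s) (R \<times> B)"
    using f has_sum_reindex_bij_betw[OF h] by blast
  then have sm: "(\<lambda>p. f (h p)) summable_on (R \<times> B)"
    by (rule has_sum_imp_summable)
  have "s = (\<Sum>\<^sub>\<infinity>r\<in>R. \<Sum>\<^sub>\<infinity>b\<in>B. f (h (r, b)))"
    using infsumI[OF fh] infsum_Sigma_banach[OF sm] by simp
  then show "s = (\<Sum>r\<in>R. \<Sum>\<^sub>\<infinity>b\<in>B. f (h (r, b)))"
    using R by simp
  show "(\<lambda>b. f (h (r, b))) summable_on B" if "r \<in> R"
  proof -
    have "(\<lambda>p. f (h p)) summable_on ({r} \<times> B)"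
      by (rule summable_on_subset_banach[OF sm]) (use that in blast)
    also have "?this \<longleftrightarrow> ?thesis"
      by (rule summable_on_reindex_bij_witness[of _ "Pair r" snd]) force+
    finally show ?thesis .
  qed
qed

section \<open>Bilateral theta series and the pentagonal number theorem\<close>

definition theta_term :: "complex \<Rightarrow> complex \<Rightarrow> int \<Rightarrow> complex" where
  "theta_term q z j = q powi tri j * z powi j"

definition theta :: "complex \<Rightarrow> complex \<Rightarrow> complex" where
  "theta q z = infsum (theta_term q z) UNIV"

lemma theta_term_summable:
  assumes "norm q < 1" "q \<noteq> 0" "z \<noteq> 0"
  shows "(\<lambda>j. norm (theta_term q z j)) summable_on UNIV"
  unfolding theta_term_def using assms by (intro theta_summable) auto

lemma theta_has_sum:
  assumes "norm q < 1" "q \<noteq> 0" "z \<noteq> 0"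
  shows "(theta_term q z has_sum theta q z) UNIV"
  unfolding theta_def using Infinite_Sum.abs_summable_summable[OF theta_term_summable[OF assms]] by simp

lemma theta_eq_product:
  assumes "norm q < 1" "q \<noteq> 0" "z \<noteq> 0"
  shows "theta q (- z) = qpoch_inf q q * qpoch_inf z q * qpoch_inf (q / z) q"
  using infsumI[OF jacobi_triple_product[of q "- z"]] assms by (simp add: theta_def theta_term_def[abs_def])

text \<open>The product side contains the factor 1 - 1. This removes one of the three residue
  classes in the quintuple product.\<close>

lemma theta_minus_1:
  assumes "norm q < 1" "q \<noteq> 0"
  shows "theta q (- 1) = 0"
proof -
  have "qpoch 1 q n = 0" if "n \<ge> 1" for n
    using that by (auto simp: qpoch_def intro!: bexI[of _ 0])
  then have "\<forall>\<^sub>F n in sequentially. qpoch 1 q n = 0"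
    unfolding eventually_sequentially by (intro exI[of _ 1] allI impI)
  then have "qpoch 1 q \<longlonglongrightarrow> 0"
    by (rule tendsto_eventually)
  with qpoch_tendsto[OF assms(1), of 1] have "qpoch_inf 1 q = 0"
    by (rule LIMSEQ_unique)
  then show ?thesis using theta_eq_product[OF assms, of 1] by simp
qed

text \<open>In base u^3, the three factors of the triple product at z = u or z = u^2 are the residue
  classes modulo 3 of the factors of \<open>qpoch_inf u u\<close>.\<close>

lemma pentagonal_number_theorem:
  assumes "norm u < 1" "u \<noteq> 0"
  shows "theta (u ^ 3) (- u) = qpoch_inf u u" "theta (u ^ 3) (- (u\<^sup>2)) = qpoch_inf u u"
proof -
  have u3: "norm (u ^ 3) < 1" using assms by (simp add: norm_power power_less_one_iff)
  have "qpoch_inf u u = qpoch_inf u (u ^ 3) * qpoch_inf (u\<^sup>2) (u ^ 3) * qpoch_inf (u ^ 3) (u ^ 3)"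
    using qpoch_inf_dissect[OF assms(1), of 3 u] by (simp add: eval_nat_numeral mult_ac)
  moreover have "u ^ 3 / u = u\<^sup>2" "u ^ 3 / u\<^sup>2 = u"
    using assms(2) by (simp_all add: eval_nat_numeral)
  ultimately show "theta (u ^ 3) (- u) = qpoch_inf u u" "theta (u ^ 3) (- (u\<^sup>2)) = qpoch_inf u u"
    using assms u3 by (simp_all add: theta_eq_product)
qed

text \<open>Reduces identities between theta terms at monomial arguments to a comparison of signs
  and integer exponents.\<close>

lemma theta_term_monomial:
  assumes "q \<noteq> 0" "z \<noteq> 0"
  shows "theta_term (q ^ a) (c * q ^ b * z ^ d) j
    = c powi j * q powi (int a * tri j + int b * j) * z powi (int d * j)"
  using assms
  by (simp add: theta_term_def power_int_mult_distrib power_int_add power_int_mult flip: power_int_of_nat)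

text \<open>The substitution $i = m-2l+r$, $j = m+l$ makes $i + 2j = 3m + r$, so that the double sum over
  $(i,j)$ splits by the residue of the exponent of $z$ modulo 3.\<close>

lemma quintuple_term:
  assumes "q \<noteq> 0" "z \<noteq> 0" "r \<in> {0, 1, 2}"
  shows "theta_term q (- z) (m - 2 * l + int r) * theta_term (q\<^sup>2) (- (q * z\<^sup>2)) (m + l)
    = ((- 1) ^ r * q powi (tri (int r)) * z ^ r) *
      (theta_term (q ^ 3) (q ^ (r + 1) * z ^ 3) m * theta_term (q ^ 6) (- (q ^ (4 - 2 * r))) l)"
proof -
  let ?i = "m - 2 * l + int r"
  note tt = theta_term_monomial[OF assms(1,2)]
  \<comment> \<open>The cross terms in m l cancel between i^2/2 and j^2. What remains is 3 m^2/2 + 3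
    l^2, whence the bases q^3 and q^6.\<close>
  have expo: "tri ?i + (2 * tri (m + l) + (m + l))
      = tri (int r) + (3 * tri m + int (r + 1) * m) + (6 * tri l + int (4 - 2 * r) * l)"
    using two_tri[of ?i] two_tri[of "m + l"] two_tri[of "int r"] two_tri[of m] two_tri[of l] assms(3)
    by (auto simp: algebra_simps)
  have sgn: "(- 1 :: complex) powi ?i * (- 1) powi (m + l) = (- 1) ^ r * (- 1) powi l"
    using assms(3) by (auto simp: power_int_minus_left)
  have mult: "(a * q powi b * z powi c) * (a' * q powi b' * z powi c')
      = (a * a') * q powi (b + b') * z powi (c + c')" for a a' b b' c c'
    using assms by (simp add: power_int_add)
  have t: "theta_term q (- z) ?i = (- 1) powi ?i * q powi tri ?i * z powi ?i"
    "theta_term (q\<^sup>2) (- (q * z\<^sup>2)) (m + l)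
      = (- 1) powi (m + l) * q powi (2 * tri (m + l) + (m + l)) * z powi (2 * (m + l))"
    "theta_term (q ^ 3) (q ^ (r + 1) * z ^ 3) m
      = 1 * q powi (3 * tri m + int (r + 1) * m) * z powi (3 * m)"
    "theta_term (q ^ 6) (- (q ^ (4 - 2 * r))) l
      = (- 1) powi l * q powi (6 * tri l + int (4 - 2 * r) * l) * z powi 0"
    using tt[of 1 "- 1" 0 1 ?i] tt[of 2 "- 1" 1 2 "m + l"] tt[of 3 1 "r + 1" 3 m]
      tt[of 6 "- 1" "4 - 2 * r" 0 l] by simp_all
  have "theta_term q (- z) ?i * theta_term (q\<^sup>2) (- (q * z\<^sup>2)) (m + l)
     = ((- 1) powi ?i * (- 1) powi (m + l)) * q powi (tri ?i + (2 * tri (m + l) + (m + l)))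
       * z powi (?i + 2 * (m + l))"
    unfolding t mult ..
  moreover have "((- 1) ^ r * q powi (tri (int r)) * z powi int r) *
      (theta_term (q ^ 3) (q ^ (r + 1) * z ^ 3) m * theta_term (q ^ 6) (- (q ^ (4 - 2 * r))) l)
    = ((- 1) ^ r * (- 1) powi l) * q powi (tri (int r) + (3 * tri m + int (r + 1) * m) + (6 * tri l + int (4 - 2 * r) * l))
       * z powi (int r + 3 * m)"
    unfolding t mult by (simp only: mult_1 add.assoc add_0_right)
  moreover have "?i + 2 * (m + l) = int r + 3 * m" by simp
  ultimately show ?thesis using expo sgn by (simp only: power_int_of_nat)
qed

text \<open>The left side, times (q^2;q^2)_inf, is a product of two theta series, sorted by the
  power of z modulo 3. Class 2 contains \<open>theta (q ^ 6) (- 1) = 0\<close>; in classes 0 and 1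
  the factor in base q^6 is again (q^2;q^2)_inf by the pentagonal number theorem, and it
  cancels.\<close>

lemma quintuple_product:
  assumes "norm q < 1" "q \<noteq> 0" "z \<noteq> 0"
  shows "qpoch_inf q q * qpoch_inf z q * qpoch_inf (q / z) q
      * (qpoch_inf (q * z\<^sup>2) (q\<^sup>2) * qpoch_inf (q / z\<^sup>2) (q\<^sup>2))
    = theta (q ^ 3) (q * z ^ 3) - z * theta (q ^ 3) (q\<^sup>2 * z ^ 3)"
proof -
  have nrm: "norm (q ^ k) < 1" if "k > 0" for k
    using assms that by (simp add: norm_power power_less_one_iff)
  let ?h = "\<lambda>(r, m, l). (m - 2 * l + int r, m + l)"
  let ?f = "\<lambda>(i, j). theta_term q (- z) i * theta_term (q\<^sup>2) (- (q * z\<^sup>2)) j"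
  let ?K = "\<lambda>r. (- 1) ^ r * q powi (tri (int r)) * z ^ r"
  have sum: "(?f has_sum (theta q (- z) * theta (q\<^sup>2) (- (q * z\<^sup>2)))) (UNIV \<times> UNIV)"
    unfolding theta_def using assms nrm by (intro has_sum_product_abs theta_term_summable) auto
  have bij: "bij_betw ?h ({0, 1, 2} \<times> UNIV) (UNIV \<times> UNIV)"
    by (rule bij_betw_byWitness[where f' = "\<lambda>(i, j). (nat ((i + 2 * j) mod 3), (i + 2 * j) div 3, j - (i + 2 * j) div 3)"])
       (auto, (presburger+)?)
  have part: "(\<Sum>\<^sub>\<infinity>b. ?f (?h (r, b)))
      = ?K r * (theta (q ^ 3) (q ^ (r + 1) * z ^ 3) * theta (q ^ 6) (- (q ^ (4 - 2 * r))))"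
    if r: "r \<in> {0, 1, 2}" for r
  proof -
    have "((\<lambda>(m, l). theta_term (q ^ 3) (q ^ (r + 1) * z ^ 3) m * theta_term (q ^ 6) (- (q ^ (4 - 2 * r))) l)
        has_sum theta (q ^ 3) (q ^ (r + 1) * z ^ 3) * theta (q ^ 6) (- (q ^ (4 - 2 * r)))) (UNIV \<times> UNIV)"
      unfolding theta_def using assms nrm by (intro has_sum_product_abs theta_term_summable) auto
    from infsumI[OF has_sum_cmult_right[OF this, of "?K r"]] show ?thesis
      using quintuple_term[OF assms(2,3) r] by (simp add: case_prod_unfold)
  qed
  have "theta q (- z) * theta (q\<^sup>2) (- (q * z\<^sup>2))
      = (\<Sum>r\<in>{0, 1, 2}. ?K r * (theta (q ^ 3) (q ^ (r + 1) * z ^ 3) * theta (q ^ 6) (- (q ^ (4 - 2 * r)))))"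
    by (subst has_sum_fibres(1)[OF sum _ bij]) (simp, rule sum.cong[OF refl part])
  also have "\<dots> = theta (q ^ 3) (q * z ^ 3) * theta (q ^ 6) (- (q ^ 4))
      - z * theta (q ^ 3) (q\<^sup>2 * z ^ 3) * theta (q ^ 6) (- (q\<^sup>2))"
    using theta_minus_1[of "q ^ 6"] nrm assms by (simp add: power2_eq_square)
  also have "theta (q ^ 6) (- (q ^ 4)) = qpoch_inf (q\<^sup>2) (q\<^sup>2)"
    using pentagonal_number_theorem(2)[of "q\<^sup>2"] nrm assms by simp
  also have "theta (q ^ 6) (- (q\<^sup>2)) = qpoch_inf (q\<^sup>2) (q\<^sup>2)"
    using pentagonal_number_theorem(1)[of "q\<^sup>2"] nrm assms by simp
  also have "theta q (- z) = qpoch_inf q q * qpoch_inf z q * qpoch_inf (q / z) q"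
    using assms by (rule theta_eq_product)
  also have "theta (q\<^sup>2) (- (q * z\<^sup>2))
      = qpoch_inf (q\<^sup>2) (q\<^sup>2) * qpoch_inf (q * z\<^sup>2) (q\<^sup>2) * qpoch_inf (q / z\<^sup>2) (q\<^sup>2)"
    using theta_eq_product[of "q\<^sup>2" "q * z\<^sup>2"] nrm[of 2] assms by (simp add: power2_eq_square)
  finally have "qpoch_inf (q\<^sup>2) (q\<^sup>2) * (qpoch_inf q q * qpoch_inf z q * qpoch_inf (q / z) q
      * (qpoch_inf (q * z\<^sup>2) (q\<^sup>2) * qpoch_inf (q / z\<^sup>2) (q\<^sup>2)))
    = qpoch_inf (q\<^sup>2) (q\<^sup>2) * (theta (q ^ 3) (q * z ^ 3) - z * theta (q ^ 3) (q\<^sup>2 * z ^ 3))"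
    by (simp only: right_diff_distrib mult_ac)
  then show ?thesis
    using qpoch_inf_self_nz[OF nrm[of 2]] by (simp only: mult_cancel_left) simp
qed

text \<open>The numerator in the evaluation of E_0; \<open>slater_odd\<close> is that of
  O_1.\<close>

definition slater_even :: "complex \<Rightarrow> complex" where
  "slater_even q = qpochs_inf [q, q ^ 7, q ^ 8] (q ^ 8) * qpochs_inf [q ^ 6, q ^ 10] (q ^ 16)"

definition slater_odd :: "complex \<Rightarrow> complex" where
  "slater_odd q = qpochs_inf [q ^ 3, q ^ 5, q ^ 8] (q ^ 8) * qpochs_inf [q ^ 2, q ^ 14] (q ^ 16)"

text \<open>The quintuple product in base q^8 at z = q and at z = q^3.\<close>

lemma slater_quintuple:
  assumes "norm q < 1" "q \<noteq> 0"
  shows "slater_even q = theta (q ^ 24) (q ^ 11) - q * theta (q ^ 24) (q ^ 19)"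
    and "slater_odd q = theta (q ^ 24) (q ^ 17) - q ^ 3 * theta (q ^ 24) (q ^ 25)"
proof -
  have nrm: "norm (q ^ 8) < 1"
    using assms by (simp add: norm_power power_less_one_iff)
  have div: "q ^ 8 / q = q ^ 7" "q ^ 8 / q\<^sup>2 = q ^ 6" "q ^ 8 / q ^ 3 = q ^ 5" "q ^ 8 / q ^ 6 = q\<^sup>2"
    using assms by (simp_all add: divide_simps flip: power_add power_Suc power_Suc2)
  show "slater_even q = theta (q ^ 24) (q ^ 11) - q * theta (q ^ 24) (q ^ 19)"
    using quintuple_product[OF nrm, of q] assms
    by (simp add: slater_even_def qpochs_inf_def div mult_ac flip: power_mult power_add)
  show "slater_odd q = theta (q ^ 24) (q ^ 17) - q ^ 3 * theta (q ^ 24) (q ^ 25)"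
    using quintuple_product[OF nrm, of "q ^ 3"] assms
    by (simp add: slater_odd_def qpochs_inf_def div mult_ac flip: power_mult power_add)
qed

text \<open>The substitution j = -m - 1 in the bilateral series. It aligns theta arguments that
  differ only by the direction of summation.\<close>

lemma theta_reflect:
  assumes "q \<noteq> 0" "z \<noteq> 0"
  shows "theta q z = q / z * theta q (q\<^sup>2 / z)"
proof -
  have "theta_term q z (- m - 1) = q / z * theta_term q (q\<^sup>2 / z) m" for m
  proof -
    have "tri (- m - 1) = tri m + 2 * m + 1"
      using two_tri[of "- m - 1"] two_tri[of m] by (simp add: algebra_simps)
    then show ?thesis using assms
      by (simp add: theta_term_def power_int_add power_int_diff power_int_minus power_int_mult
          power_int_divide_distrib divide_simps)
  qed
  moreover have "theta q z = (\<Sum>\<^sub>\<infinity>m. theta_term q z (- m - 1))"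
    unfolding theta_def
    by (rule infsum_reindex_bij_witness[of _ "\<lambda>m. - m - 1" "\<lambda>m. - m - 1"]) simp_all
  ultimately show ?thesis by (simp only: theta_def infsum_cmult_right')
qed

section \<open>Slater's identities\<close>

text \<open>Splitting the pentagonal number series modulo 4. Since $n(3n-1)/2$ is odd exactly for
  $n \<equiv> 1, 2$ modulo 4, the two parities of the exponent give the two products.\<close>

lemma pentagonal_dissection:
  assumes "norm u < 1" "u \<noteq> 0"
  shows "qpoch_inf u u = slater_even (u\<^sup>2) - u * slater_odd (u\<^sup>2)"
proof -
  have nrm: "norm (u ^ k) < 1" if "k > 0" for k
    using assms that by (simp add: norm_power power_less_one_iff)
  let ?f = "theta_term (u ^ 3) (- u)"
  let ?h = "\<lambda>(r, m). 4 * m + int r"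
  have sum: "(?f has_sum qpoch_inf u u) UNIV"
    using theta_has_sum[of "u ^ 3" "- u"] pentagonal_number_theorem(1)[OF assms] nrm[of 3] assms by simp
  have bij: "bij_betw ?h ({0, 1, 2, 3} \<times> UNIV) UNIV"
    by (rule bij_betw_byWitness[where f' = "\<lambda>n. (nat (n mod 4), n div 4)"]) (auto, (presburger+)?)
  \<comment> \<open>For n = 4m + r the exponent 3 tri(n) + n has quadratic part 24 m^2 = 48 tri(m) +
    24 m, which leaves the linear coefficient 22 + 12 r.\<close>
  have part: "?f (4 * m + int r) = (- u) ^ r * u ^ (3 * (r * (r - 1) div 2)) * theta_term (u ^ 48) (u ^ (22 + 12 * r)) m"
    if r: "r \<in> {0, 1, 2, 3}" for r m
  proof -
    have e: "3 * tri (4 * m + int r) + (4 * m + int r)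
        = int r + int (3 * (r * (r - 1) div 2)) + (48 * tri m + int (22 + 12 * r) * m)"
      using two_tri[of "4 * m + int r"] two_tri[of m] r by (auto simp: algebra_simps)
    have s: "(- 1 :: complex) powi (4 * m + int r) = (- 1) ^ r"
      using r by (auto simp: power_int_minus_left)
    show ?thesis
      using theta_term_monomial[of u 1 3 "- 1" 1 0 "4 * m + int r"] theta_term_monomial[of u 1 48 1 "22 + 12 * r" 0 m]
        e s assms(2)
      by (simp add: power_int_add power_minus[of u] del: of_nat_add of_nat_mult of_nat_diff)
  qed
  have "qpoch_inf u u = (\<Sum>r\<in>{0, 1, 2, 3}. \<Sum>\<^sub>\<infinity>m. ?f (?h (r, m)))"
    by (rule has_sum_fibres(1)[OF sum _ bij]) simp
  also have "\<dots> = (\<Sum>r\<in>{0, 1, 2, 3}. (- u) ^ r * u ^ (3 * (r * (r - 1) div 2)) * theta (u ^ 48) (u ^ (22 + 12 * r)))"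
    by (intro sum.cong refl) (simp only: part prod.case theta_def infsum_cmult_right')
  also have "\<dots> = theta (u ^ 48) (u ^ 22) - u * theta (u ^ 48) (u ^ 34) + u ^ 5 * theta (u ^ 48) (u ^ 46)
      - u ^ 12 * theta (u ^ 48) (u ^ 58)"
  proof -
    have "u\<^sup>2 * u ^ 3 = u ^ 5" "u ^ 3 * u ^ 9 = u ^ 12" by (simp_all flip: power_add)
    then show ?thesis by (simp add: power_minus_odd flip: mult.assoc)
  qed
  \<comment> \<open>Classes 2 and 3 appear at u^46 and u^58, whereas \<open>slater_quintuple\<close>
    at u^2 has u^50 and u^38; reflection matches them.\<close>
  also have "theta (u ^ 48) (u ^ 46) = u\<^sup>2 * theta (u ^ 48) (u ^ 50)"
  proof -
    have "u ^ 48 / u ^ 46 = u\<^sup>2" "(u ^ 48)\<^sup>2 / u ^ 46 = u ^ 50"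
      using assms(2) power_diff[of u 46 48] power_diff[of u 46 96] by (simp_all flip: power_mult)
    then show ?thesis using theta_reflect[of "u ^ 48" "u ^ 46"] assms(2) by simp
  qed
  also have "u ^ 12 * theta (u ^ 48) (u ^ 58) = u\<^sup>2 * theta (u ^ 48) (u ^ 38)"
  proof -
    have "u ^ 48 / u ^ 38 = u ^ 10" "(u ^ 48)\<^sup>2 / u ^ 38 = u ^ 58"
      using assms(2) power_diff[of u 38 48] power_diff[of u 38 96] by (simp_all flip: power_mult)
    then have "theta (u ^ 48) (u ^ 38) = u ^ 10 * theta (u ^ 48) (u ^ 58)"
      using theta_reflect[of "u ^ 48" "u ^ 38"] assms(2) by simp
    moreover have "u ^ 12 = u\<^sup>2 * u ^ 10" by (simp flip: power_add)
    ultimately show ?thesis by simp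
  qed
  finally have "qpoch_inf u u = theta (u ^ 48) (u ^ 22) - u * theta (u ^ 48) (u ^ 34)
      + u ^ 5 * (u\<^sup>2 * theta (u ^ 48) (u ^ 50)) - u\<^sup>2 * theta (u ^ 48) (u ^ 38)" .
  moreover have "slater_even (u\<^sup>2) = theta (u ^ 48) (u ^ 22) - u\<^sup>2 * theta (u ^ 48) (u ^ 38)"
    using slater_quintuple(1)[of "u\<^sup>2"] nrm[of 2] assms by (simp flip: power_mult)
  moreover have "slater_odd (u\<^sup>2) = theta (u ^ 48) (u ^ 34) - u ^ 6 * theta (u ^ 48) (u ^ 50)"
    using slater_quintuple(2)[of "u\<^sup>2"] nrm[of 2] assms by (simp flip: power_mult)
  moreover have "u ^ 5 * u\<^sup>2 = u * u ^ 6" by (simp flip: power_add power_Suc)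
  ultimately show ?thesis by (simp add: right_diff_distrib flip: mult.assoc)
qed

definition even_term :: "complex \<Rightarrow> nat \<Rightarrow> nat \<Rightarrow> complex" where
  "even_term q m n = q ^ (2 * n\<^sup>2 + 2 * m * n) / qpoch q q (2 * n)"

definition odd_term :: "complex \<Rightarrow> nat \<Rightarrow> nat \<Rightarrow> complex" where
  "odd_term q m n = q ^ (2 * n\<^sup>2 + 2 * m * n) / qpoch q q (2 * n + 1)"

text \<open>For k = 2n the factor t^(2n) = q^n completes the exponent n (2n - 1) to 2n^2. For k = 2n
  + 1 one factor t q^m stays outside and the parameter rises to m + 1.\<close>

lemma euler_split:
  assumes "norm t < 1" "t \<noteq> 0" and q: "q = t\<^sup>2"
  shows "summable (even_term q m)" and "summable (odd_term q (Suc m))"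
    and "qpoch_inf (- (t * q ^ m)) q = suminf (even_term q m) + t * q ^ m * suminf (odd_term q (Suc m))"
proof -
  have q1: "norm q < 1" and q0: "q \<noteq> 0"
    using assms by (simp_all add: q norm_power power_less_one_iff)
  let ?x = "t * q ^ m"
  let ?f = "\<lambda>k. q powi tri (int k) * ?x ^ k / qpoch q q k"
  let ?h = "\<lambda>(r, n). 2 * n + r"
  have sum: "(?f has_sum qpoch_inf (- ?x) q) UNIV"
    by (rule euler_identity[OF q1 q0])
  have bij: "bij_betw ?h ({0, 1} \<times> UNIV) (UNIV :: nat set)"
    by (rule bij_betw_byWitness[where f' = "\<lambda>k. (k mod 2, k div 2)"]) auto
  have "2 * tri (int (2 * n)) + 2 * int n = 2 * int (2 * n\<^sup>2)" for n
    by (simp add: two_tri algebra_simps power2_eq_square)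
  then have tri_even: "tri (int (2 * n)) + int n = int (2 * n\<^sup>2)" for n
    by (smt (verit))
  have "q powi tri (int (2 * n)) * q ^ n = q ^ (2 * n\<^sup>2)" for n
    using tri_even[of n] power_int_add[of q "tri (int (2 * n))" "int n"] q0
    by (simp only: power_int_of_nat simp_thms)
  moreover have x_even: "?x ^ (2 * n) = q ^ n * q ^ (2 * m * n)" for n
    by (simp add: power_mult_distrib q mult_ac flip: power_mult)
  ultimately have f0: "?f (2 * n) = even_term q m n" for n
    by (simp add: even_term_def power_add)
  have "tri (int (2 * n + 1)) = int (2 * n\<^sup>2 + n)" for n
    using tri_add_1[of "int (2 * n)"] tri_even[of n] by (simp add: add.commute)
  then have tri_odd: "q powi tri (int (2 * n + 1)) = q ^ (2 * n\<^sup>2 + n)" for n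
    by (simp only: power_int_of_nat)
  have f1: "?f (2 * n + 1) = ?x * odd_term q (Suc m) n" for n
  proof -
    have "2 * n\<^sup>2 + n + (n + 2 * m * n) = 2 * n\<^sup>2 + 2 * Suc m * n" by simp
    then have "q ^ (2 * n\<^sup>2 + n) * (q ^ n * q ^ (2 * m * n)) = q ^ (2 * n\<^sup>2 + 2 * Suc m * n)"
      by (simp only: power_add[symmetric])
    moreover have "?x ^ (2 * n + 1) = q ^ n * q ^ (2 * m * n) * ?x"
      by (simp only: power_add x_even power_one_right)
    ultimately show ?thesis
      by (simp only: tri_odd odd_term_def mult.assoc[symmetric]) (simp add: mult.commute)
  qed
  have even: "(even_term q m) summable_on UNIV"
    using has_sum_fibres(2)[OF sum _ bij, of 0] by (simp only: prod.case add_0_right f0) simp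
  have "(\<lambda>n. ?x * odd_term q (Suc m) n) summable_on UNIV"
    using has_sum_fibres(2)[OF sum _ bij, of 1] by (simp only: f1 prod.case) simp
  then have odd: "(odd_term q (Suc m)) summable_on UNIV"
    using q0 assms(2) by (subst (asm) summable_on_cmult_right') simp_all
  have sums: "even_term q m sums infsum (even_term q m) UNIV"
    "odd_term q (Suc m) sums infsum (odd_term q (Suc m)) UNIV"
    by (rule has_sum_imp_sums[OF has_sum_infsum[OF even]], rule has_sum_imp_sums[OF has_sum_infsum[OF odd]])
  have "qpoch_inf (- ?x) q = (\<Sum>r\<in>{0, 1}. \<Sum>\<^sub>\<infinity>n. ?f (?h (r, n)))"
    by (rule has_sum_fibres(1)[OF sum _ bij]) simp
  also have "\<dots> = (\<Sum>\<^sub>\<infinity>n. ?f (2 * n)) + (\<Sum>\<^sub>\<infinity>n. ?f (2 * n + 1))"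
    by (simp add: add.commute)
  also have "\<dots> = infsum (even_term q m) UNIV + ?x * infsum (odd_term q (Suc m)) UNIV"
    by (simp only: f0 f1 infsum_cmult_right')
  finally show "qpoch_inf (- ?x) q = suminf (even_term q m) + ?x * suminf (odd_term q (Suc m))"
    using sums by (simp add: sums_iff)
  show "summable (even_term q m)" "summable (odd_term q (Suc m))"
    using sums by (auto simp: sums_iff)
qed

text \<open>Both square roots $t$ of $q$ satisfy $(-t;q)_\<infinity> (q;q)_\<infinity> = (-t;-t)_\<infinity>$; comparing the two
  signs separates the even from the odd part.\<close>

lemma slater_identities:
  assumes "0 < norm q" "norm q < 1"
  shows "suminf (even_term q 0) = slater_even q / qpoch_inf q q"
    and "suminf (odd_term q 1) = slater_odd q / qpoch_inf q q"
proof -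
  let ?E = "suminf (even_term q 0)" and ?O = "suminf (odd_term q 1)"
  define u where "u = csqrt q"
  have u: "u\<^sup>2 = q" "u \<noteq> 0"
    using assms by (auto simp: u_def)
  have "norm u < 1"
    using assms by (simp add: u_def norm_csqrt)
  have *: "(?E + t * ?O) * qpoch_inf q q = slater_even q + t * slater_odd q" if t: "t\<^sup>2 = q" "norm t < 1" for t
  proof -
    have t0: "t \<noteq> 0" using t assms by auto
    \<comment> \<open>Even and odd powers of the base -t: the odd ones form the first factor and the
      even ones the second, both in base t^2 = q.\<close>
    have "qpoch_inf (- t) (- t) = qpoch_inf (- t) q * qpoch_inf q q"
      using qpoch_inf_dissect[of "- t" 2 "- t"] t by (simp add: eval_nat_numeral)
    moreover have "qpoch_inf (- t) q = ?E + t * ?O"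
      using euler_split(3)[OF t(2) t0 t(1)[symmetric], of 0] by simp
    ultimately show ?thesis
      using pentagonal_dissection[of "- t"] t t0 by simp
  qed
  from *[OF u(1) \<open>norm u < 1\<close>] *[of "- u"] u \<open>norm u < 1\<close>
  have p: "?E * qpoch_inf q q + u * (?O * qpoch_inf q q) = slater_even q + u * slater_odd q"
    and m: "?E * qpoch_inf q q - u * (?O * qpoch_inf q q) = slater_even q - u * slater_odd q"
    by (simp_all add: algebra_simps)
  have "?E * qpoch_inf q q = slater_even q"
    using arg_cong2[OF p m, of "(+)"] by (simp add: mult.commute)
  moreover from this p have "?O * qpoch_inf q q = slater_odd q" using u(2) by simp
  ultimately show "?E = slater_even q / qpoch_inf q q" "?O = slater_odd q / qpoch_inf q q"
    using qpoch_inf_self_nz[OF assms(2)] by (simp_all add: field_simps)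
qed

lemma slater_sums:
  assumes "0 < norm q" "norm q < 1"
  shows "even_term q m sums suminf (even_term q m)"
    and "odd_term q (Suc m) sums suminf (odd_term q (Suc m))"
proof -
  have "norm (csqrt q) < 1" "csqrt q \<noteq> 0" "q = (csqrt q)\<^sup>2"
    using assms by (auto simp: norm_csqrt)
  from euler_split(1,2)[OF this] show "even_term q m sums suminf (even_term q m)"
    "odd_term q (Suc m) sums suminf (odd_term q (Suc m))"
    by (simp_all add: summable_sums)
qed

section \<open>Contiguous relations between the two families of sums\<close>

lemma contiguous_even:
  assumes "0 < norm q" "norm q < 1"
  shows "suminf (even_term q (Suc m)) = suminf (odd_term q (Suc m)) - q * suminf (odd_term q (Suc (Suc m)))"
proof (rule sums_unique2)
  show "even_term q (Suc m) sums suminf (even_term q (Suc m))"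
    by (rule slater_sums[OF assms])
  have "odd_term q (Suc m) n - q * odd_term q (Suc (Suc m)) n = even_term q (Suc m) n" for n
  proof -
    have "q * q ^ (2 * n\<^sup>2 + 2 * Suc (Suc m) * n) = q ^ (2 * n\<^sup>2 + 2 * Suc m * n) * (q * q ^ (2 * n))"
    proof -
      have "Suc (2 * n\<^sup>2 + 2 * Suc (Suc m) * n) = 2 * n\<^sup>2 + 2 * Suc m * n + Suc (2 * n)"
        by simp
      then show ?thesis
        by (simp only: power_add[symmetric] power_Suc[symmetric])
    qed
    then have "odd_term q (Suc m) n - q * odd_term q (Suc (Suc m)) n
        = q ^ (2 * n\<^sup>2 + 2 * Suc m * n) * (1 - q * q ^ (2 * n)) / (qpoch q q (2 * n) * (1 - q * q ^ (2 * n)))"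
      by (simp only: odd_term_def times_divide_eq_right right_diff_distrib diff_divide_distrib
          mult_1_right Suc_eq_plus1[symmetric] qpoch_simps)
    then show ?thesis
      using power_neq_1[OF assms(2), of "Suc (2 * n)"] by (simp add: even_term_def)
  qed
  then show "even_term q (Suc m) sums (suminf (odd_term q (Suc m)) - q * suminf (odd_term q (Suc (Suc m))))"
    using sums_diff[OF slater_sums(2)[OF assms, of m] sums_mult[OF slater_sums(2)[OF assms, of "Suc m"], of q]]
    by simp
qed

text \<open>Raising m multiplies the n-th term by q^(2n), so the difference has the factor 1 -
  q^(2n), the last one of (q;q)_{2n}. The term n = 0 vanishes, and shifting n by one gives the odd
  family.\<close>

lemma contiguous_odd:
  assumes "0 < norm q" "norm q < 1"
  shows "suminf (even_term q m) - suminf (even_term q (Suc m)) = q ^ (2 * m + 2) * suminf (odd_term q (Suc (Suc m)))"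
proof (rule sums_unique2)
  let ?d = "\<lambda>n. even_term q m n - even_term q (Suc m) n"
  show "?d sums (suminf (even_term q m) - suminf (even_term q (Suc m)))"
    by (intro sums_diff slater_sums[OF assms])
  have "?d (Suc n) = q ^ (2 * m + 2) * odd_term q (Suc (Suc m)) n" for n
  proof -
    have "2 * (Suc n)\<^sup>2 + 2 * Suc m * Suc n = 2 * (Suc n)\<^sup>2 + 2 * m * Suc n + (2 * n + 2)"
      by simp
    then have "?d (Suc n) = q ^ (2 * (Suc n)\<^sup>2 + 2 * m * Suc n) * (1 - q ^ (2 * n + 2)) / qpoch q q (2 * n + 2)"
      by (simp only: even_term_def power_add right_diff_distrib diff_divide_distrib) simp
    also have "qpoch q q (2 * n + 2) = qpoch q q (2 * n + 1) * (1 - q ^ (2 * n + 2))"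
      by simp
    also have "2 * (Suc n)\<^sup>2 + 2 * m * Suc n = (2 * m + 2) + (2 * n\<^sup>2 + 2 * Suc (Suc m) * n)"
      by (simp add: power2_eq_square)
    also have "q ^ \<dots> = q ^ (2 * m + 2) * q ^ (2 * n\<^sup>2 + 2 * Suc (Suc m) * n)"
      by (rule power_add)
    finally show ?thesis
      using power_neq_1[OF assms(2), of "2 * n + 2"] by (simp add: odd_term_def del: qpoch_simps)
  qed
  then have "(\<lambda>n. ?d (Suc n)) sums (q ^ (2 * m + 2) * suminf (odd_term q (Suc (Suc m))))"
    using sums_mult[OF slater_sums(2)[OF assms, of "Suc m"], of "q ^ (2 * m + 2)"] by simp
  moreover have "?d 0 = 0" by (simp add: even_term_def)
  ultimately show "?d sums (q ^ (2 * m + 2) * suminf (odd_term q (Suc (Suc m))))"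
    using sums_Suc_iff[of ?d] by simp
qed

section \<open>Recurrences in the parameter\<close>

lemma second_order_recurrence_unique:
  fixes X Y :: "nat \<Rightarrow> complex"
  assumes "\<And>k. X (Suc (Suc k)) = a k * X (Suc k) + b k * X k"
    and "\<And>k. Y (Suc (Suc k)) = a k * Y (Suc k) + b k * Y k"
    and "X 0 = Y 0" "X 1 = Y 1"
  shows "X k = Y k"
  by (induction k rule: induct_nat_012) (use assms in simp_all)

text \<open>Makes all powers polynomial in q and y = q^k, so that the recurrences become ring
  identities within reach of \<open>algebra\<close>.\<close>

lemma even_power_splits:
  fixes q :: "'a :: comm_semiring_1"
  shows "q ^ (2 * k + 2) = (q ^ k)\<^sup>2 * q\<^sup>2" "q ^ (2 * Suc k + 2) = (q ^ k)\<^sup>2 * q ^ 4"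
    and "(q\<^sup>2) ^ k = (q ^ k)\<^sup>2"
proof -
  have "2 * Suc k + 2 = 2 * k + 4" by simp
  then show "q ^ (2 * Suc k + 2) = (q ^ k)\<^sup>2 * q ^ 4"
    by (simp only: power_add power_even_eq)
qed (simp_all only: power_add power_even_eq power_mult_distrib power2_eq_square)

text \<open>Eliminating E gives q (1 - q^(2k+3)) O_{k+3} = (1 + q) O_{k+2} - O_{k+1}. The
  normalisation absorbs the left coefficient and turns that of O_{k+1} into -q (1 - q^(2k+1)) =
  q^(2k+2) - q.\<close>

lemma odd_sum_closed_form:
  assumes q: "0 < norm q" "norm q < 1"
    and P: "P 0 = 1" "P 1 = 1" "\<And>k. P (Suc (Suc k)) = (1 + q) * P (Suc k) + (q ^ (2 * k + 2) - q) * P k"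
    and Q: "Q 0 = 0" "Q 1 = 1" "\<And>k. Q (Suc (Suc k)) = (1 + q) * Q (Suc k) + (q ^ (2 * k + 2) - q) * Q k"
  shows "q ^ k * qpoch q (q\<^sup>2) k * suminf (odd_term q (Suc k))
    = suminf (odd_term q 1) * P k - suminf (even_term q 0) * Q k"
proof (rule second_order_recurrence_unique[where a = "\<lambda>_. 1 + q" and b = "\<lambda>k. q ^ (2 * k + 2) - q"])
  let ?o = "\<lambda>k. suminf (odd_term q k)" and ?e = "\<lambda>k. suminf (even_term q k)"
  show "q ^ Suc (Suc k) * qpoch q (q\<^sup>2) (Suc (Suc k)) * ?o (Suc (Suc (Suc k)))
      = (1 + q) * (q ^ Suc k * qpoch q (q\<^sup>2) (Suc k) * ?o (Suc (Suc k)))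
        + (q ^ (2 * k + 2) - q) * (q ^ k * qpoch q (q\<^sup>2) k * ?o (Suc k))" for k
  proof -
    define D y where "D = qpoch q (q\<^sup>2) k" and "y = q ^ k"
    note y = even_power_splits[of q k, folded y_def]
    have "?o (Suc k) - q * ?o (Suc (Suc k)) - (?o (Suc (Suc k)) - q * ?o (Suc (Suc (Suc k))))
        = y\<^sup>2 * q ^ 4 * ?o (Suc (Suc (Suc k)))"
      using contiguous_even[OF q, of k] contiguous_even[OF q, of "Suc k"] contiguous_odd[OF q, of "Suc k"]
      by (simp only: y)
    then have "q * (1 - q * (q\<^sup>2 * y\<^sup>2)) * ?o (Suc (Suc (Suc k))) = (1 + q) * ?o (Suc (Suc k)) - ?o (Suc k)"
      by algebra
    then have "q * q * y * (D * (1 - q * y\<^sup>2) * (1 - q * (q\<^sup>2 * y\<^sup>2))) * ?o (Suc (Suc (Suc k)))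
      = (1 + q) * (q * y * (D * (1 - q * y\<^sup>2)) * ?o (Suc (Suc k))) + (y\<^sup>2 * q\<^sup>2 - q) * (y * D * ?o (Suc k))"
      by algebra
    then show ?thesis
      by (simp only: qpoch_simps power_Suc y y_def[symmetric] D_def[symmetric] mult.assoc)
  qed
  show "suminf (odd_term q 1) * P (Suc (Suc k)) - suminf (even_term q 0) * Q (Suc (Suc k))
     = (1 + q) * (suminf (odd_term q 1) * P (Suc k) - suminf (even_term q 0) * Q (Suc k))
       + (q ^ (2 * k + 2) - q) * (suminf (odd_term q 1) * P k - suminf (even_term q 0) * Q k)" for k
    unfolding P(3) Q(3) by algebra
  show "q ^ 0 * qpoch q (q\<^sup>2) 0 * ?o (Suc 0) = ?o 1 * P 0 - ?e 0 * Q 0"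
    using P Q by simp
  have "?e 0 = ?o 1 - q * ?o 2 + q\<^sup>2 * ?o 2"
    using contiguous_odd[OF q, of 0] contiguous_even[OF q, of 0]
    by (simp add: numeral_2_eq_2 algebra_simps)
  then show "q ^ 1 * qpoch q (q\<^sup>2) 1 * ?o (Suc 1) = ?o 1 * P 1 - ?e 0 * Q 1"
    using P Q by (simp add: numeral_2_eq_2 algebra_simps)
qed

text \<open>Eliminating O gives (1 - q^(2k+3)) E_{k+2} = (1 + q) E_{k+1} - q E_k. Here the factor q
  is already present, so no power of q enters the normalisation.\<close>

lemma even_sum_closed_form:
  assumes q: "0 < norm q" "norm q < 1"
    and A: "A 0 = 1" "A 1 = 1" "\<And>k. A (Suc (Suc k)) = (1 + q) * A (Suc k) + (q ^ (2 * k + 2) - q) * A k"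
    and B: "B 0 = 0" "B 1 = q" "\<And>k. B (Suc (Suc k)) = (1 + q) * B (Suc k) + (q ^ (2 * k + 2) - q) * B k"
  shows "qpoch q (q\<^sup>2) k * suminf (even_term q k)
    = suminf (even_term q 0) * A k - suminf (odd_term q 1) * B k"
proof (rule second_order_recurrence_unique[where a = "\<lambda>_. 1 + q" and b = "\<lambda>k. q ^ (2 * k + 2) - q"])
  let ?o = "\<lambda>k. suminf (odd_term q k)" and ?e = "\<lambda>k. suminf (even_term q k)"
  show "qpoch q (q\<^sup>2) (Suc (Suc k)) * ?e (Suc (Suc k))
      = (1 + q) * (qpoch q (q\<^sup>2) (Suc k) * ?e (Suc k)) + (q ^ (2 * k + 2) - q) * (qpoch q (q\<^sup>2) k * ?e k)" for k
  proof -
    define D y where "D = qpoch q (q\<^sup>2) k" and "y = q ^ k"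
    note y = even_power_splits[of q k, folded y_def]
    have "?e k - ?e (Suc k) = y\<^sup>2 * q\<^sup>2 * ?o (Suc (Suc k))"
      "?e (Suc k) - ?e (Suc (Suc k)) = y\<^sup>2 * q ^ 4 * ?o (Suc (Suc (Suc k)))"
      "?e (Suc (Suc k)) = ?o (Suc (Suc k)) - q * ?o (Suc (Suc (Suc k)))"
      using contiguous_even[OF q, of "Suc k"] contiguous_odd[OF q, of k] contiguous_odd[OF q, of "Suc k"]
      by (simp_all only: y)
    then have "q * ((1 - q * (q\<^sup>2 * y\<^sup>2)) * ?e (Suc (Suc k))) = q * ((1 + q) * ?e (Suc k) - q * ?e k)"
      by algebra
    then have "(1 - q * (q\<^sup>2 * y\<^sup>2)) * ?e (Suc (Suc k)) = (1 + q) * ?e (Suc k) - q * ?e k"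
      using q(1) by simp
    then have "D * (1 - q * y\<^sup>2) * (1 - q * (q\<^sup>2 * y\<^sup>2)) * ?e (Suc (Suc k))
      = (1 + q) * (D * (1 - q * y\<^sup>2) * ?e (Suc k)) + (y\<^sup>2 * q\<^sup>2 - q) * (D * ?e k)"
      by algebra
    then show ?thesis
      by (simp only: qpoch_simps power_Suc y y_def[symmetric] D_def[symmetric] mult.assoc)
  qed
  show "?e 0 * A (Suc (Suc k)) - ?o 1 * B (Suc (Suc k))
     = (1 + q) * (?e 0 * A (Suc k) - ?o 1 * B (Suc k)) + (q ^ (2 * k + 2) - q) * (?e 0 * A k - ?o 1 * B k)" for k
    unfolding A(3) B(3) by algebra
  show "qpoch q (q\<^sup>2) 0 * ?e 0 = ?e 0 * A 0 - ?o 1 * B 0"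
    using A B by simp
  have "?e 0 - ?e 1 = q\<^sup>2 * ?o 2"
    using contiguous_odd[OF q, of 0] by (simp add: numeral_2_eq_2)
  moreover have "?e 1 = ?o 1 - q * ?o 2"
    using contiguous_even[OF q, of 0] by (simp add: numeral_2_eq_2)
  ultimately have "(1 - q) * ?e 1 = ?e 0 - q * ?o 1"
    by algebra
  then show "qpoch q (q\<^sup>2) 1 * ?e 1 = ?e 0 * A 1 - ?o 1 * B 1"
    using A B by (simp add: algebra_simps)
qed

theorem theorem2p5:
  fixes q :: complex and P Q A B :: "nat \<Rightarrow> complex"
  assumes q: "0 < norm q" "norm q < 1"
    and P: "P 0 = 1" "P 1 = 1"
      "\<forall>m\<ge>2. P m = (1 + q) * P (m - 1) + (q ^ (2 * m - 2) - q) * P (m - 2)"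
    and Q: "Q 0 = 0" "Q 1 = 1"
      "\<forall>m\<ge>2. Q m = (1 + q) * Q (m - 1) + (q ^ (2 * m - 2) - q) * Q (m - 2)"
    and A: "A 0 = 1" "A 1 = 1"
      "\<forall>m\<ge>2. A m = (1 + q) * A (m - 1) + (q ^ (2 * m - 2) - q) * A (m - 2)"
    and B: "B 0 = 0" "B 1 = q"
      "\<forall>m\<ge>2. B m = (1 + q) * B (m - 1) + (q ^ (2 * m - 2) - q) * B (m - 2)"
  shows "(\<forall>m\<ge>1. (\<lambda>n. q ^ (2 * n\<^sup>2 + 2 * m * n) / qpoch q q (2 * n + 1)) sums
       (q powi (1 - int m) * qpochs_inf [q ^ 3, q ^ 5, q ^ 8] (q ^ 8) * qpochs_inf [q ^ 2, q ^ 14] (q ^ 16)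
           / (qpoch q (q\<^sup>2) (m - 1) * qpoch_inf q q) * P (m - 1)
        - q powi (1 - int m) * qpochs_inf [q, q ^ 7, q ^ 8] (q ^ 8) * qpochs_inf [q ^ 6, q ^ 10] (q ^ 16)
           / (qpoch q (q\<^sup>2) (m - 1) * qpoch_inf q q) * Q (m - 1)))
    \<and> (\<forall>m. (\<lambda>n. q ^ (2 * n\<^sup>2 + 2 * m * n) / qpoch q q (2 * n)) sums
       (qpochs_inf [q, q ^ 7, q ^ 8] (q ^ 8) * qpochs_inf [q ^ 6, q ^ 10] (q ^ 16)
           / (qpoch q (q\<^sup>2) m * qpoch_inf q q) * A m
        - qpochs_inf [q ^ 3, q ^ 5, q ^ 8] (q ^ 8) * qpochs_inf [q ^ 2, q ^ 14] (q ^ 16)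
           / (qpoch q (q\<^sup>2) m * qpoch_inf q q) * B m))"
proof (intro conjI allI impI)
  have rec: "X (Suc (Suc k)) = (1 + q) * X (Suc k) + (q ^ (2 * k + 2) - q) * X k"
    if "\<forall>m\<ge>2. X m = (1 + q) * X (m - 1) + (q ^ (2 * m - 2) - q) * X (m - 2)" for X :: "nat \<Rightarrow> complex" and k
    using that[rule_format, of "k + 2"] by simp
  have D: "qpoch q (q\<^sup>2) k \<noteq> 0" for k
    using power_neq_1[OF q(2), of "Suc (2 * _)"] by (auto simp: qpoch_def power_mult)
  note K = qpoch_inf_self_nz[OF q(2)]
  show "(\<lambda>n. q ^ (2 * n\<^sup>2 + 2 * m * n) / qpoch q q (2 * n + 1)) sums
       (q powi (1 - int m) * qpochs_inf [q ^ 3, q ^ 5, q ^ 8] (q ^ 8) * qpochs_inf [q ^ 2, q ^ 14] (q ^ 16)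
           / (qpoch q (q\<^sup>2) (m - 1) * qpoch_inf q q) * P (m - 1)
        - q powi (1 - int m) * qpochs_inf [q, q ^ 7, q ^ 8] (q ^ 8) * qpochs_inf [q ^ 6, q ^ 10] (q ^ 16)
           / (qpoch q (q\<^sup>2) (m - 1) * qpoch_inf q q) * Q (m - 1))" if "1 \<le> m" for m
  proof -
    \<comment> \<open>The closed form is normalised by q^k with k = m - 1, the origin of
      q^(1-m).\<close>
    obtain k where m: "m = Suc k" using \<open>1 \<le> m\<close> by (cases m) auto
    have "q powi (1 - int m) = inverse (q ^ k)" by (simp add: m power_int_minus)
    moreover have "suminf (odd_term q m) = inverse (q ^ k)
        * (slater_odd q / qpoch_inf q q * P k - slater_even q / qpoch_inf q q * Q k) / qpoch q (q\<^sup>2) k"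
      using odd_sum_closed_form[OF q P(1,2) rec[OF P(3)] Q(1,2) rec[OF Q(3)], of k]
        slater_identities[OF q] D[of k] q(1) by (simp add: m field_simps)
    ultimately show ?thesis
      using slater_sums(2)[OF q, of k] m
      by (simp add: odd_term_def[abs_def] slater_odd_def slater_even_def diff_divide_distrib right_diff_distrib mult_ac)
  qed
  show "(\<lambda>n. q ^ (2 * n\<^sup>2 + 2 * m * n) / qpoch q q (2 * n)) sums
       (qpochs_inf [q, q ^ 7, q ^ 8] (q ^ 8) * qpochs_inf [q ^ 6, q ^ 10] (q ^ 16)
           / (qpoch q (q\<^sup>2) m * qpoch_inf q q) * A m
        - qpochs_inf [q ^ 3, q ^ 5, q ^ 8] (q ^ 8) * qpochs_inf [q ^ 2, q ^ 14] (q ^ 16)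
           / (qpoch q (q\<^sup>2) m * qpoch_inf q q) * B m)" for m
  proof -
    have "suminf (even_term q m)
        = (slater_even q / qpoch_inf q q * A m - slater_odd q / qpoch_inf q q * B m) / qpoch q (q\<^sup>2) m"
      using even_sum_closed_form[OF q A(1,2) rec[OF A(3)] B(1,2) rec[OF B(3)], of m]
        slater_identities[OF q] D[of m] by (simp add: field_simps)
    then show ?thesis
      using slater_sums(1)[OF q, of m]
      by (simp add: even_term_def[abs_def] slater_odd_def slater_even_def diff_divide_distrib mult_ac)
  qed
qed

end
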